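(* Let $f\in\mathcal{R}_d$ and let $a,b\ge0$ satisfy $a+b\le d-3$. Then matrix multiplication defines a map $$M^f_a\times M^f_b\to M^f_{a+b},$$ and all commutators $AB-BA$ with $A\in M^f_a$, $B\in M^f_b$ belong to $\ker\gamma^f_{a+b}$. In particular, the augmentation $$\widehat M^f=\Bigl(\bigoplus_{e=0}^{d-3}M^f_e\Bigr)\oplus\Bigl(\bigoplus_{e\ge d-2}\mathrm{Mat}_{R_e}(r,r)\Bigr)$$ is a (non-commutative) graded $K$-algebra with unity.
   Context: $K$ is a field, $r\ge 1$, $R=K[\partial_1,\dots,\partial_r]$ is a polynomial ring with the standard grading, and $\mathcal{R}=K[x_1,\dots,x_r]^{DP}=\bigoplus_{d\ge0}\mathcal{R}_d$ is the divided power ring: $\mathcal{R}_d$ has $K$-basis $x^{(\alpha)}=\prod_i x_i^{(\alpha_i)}$, $|\alpha|=d$, with multiplication generated by $x_i^{(a)}x_i^{(b)}=\binom{a+b}{a}x_i^{(a+b)}$. $R$ acts on $\mathcal{R}$ by $\partial^\beta(x^{(\alpha)})=x^{(\alpha-\beta)}$ (zero if some $\alpha_i<\beta_i$). $\mathrm{ann}_R(f)=\{D\in R:Df=0\}$; $\partial=[\partial_1,\dots,\partial_r]^T$; matrices over $R$ act entrywise on matrices over $\mathcal{R}$ via matrix product with the action of $R$ as multiplication. $\mathrm{Mat}_{R_e}(r,r)$ is the $K$-space of $r\times r$ matrices with entries in $R_e$. For $f\in\mathcal{R}_d$ and $e\ge0$, $$M^f_e=\{A\in\mathrm{Mat}_{R_e}(r,r):I_2(\partial\;A\partial)\subseteq\mathrm{ann}_R(f)\},$$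 where $I_2(\partial\;A\partial)$ is the ideal of $R$ generated by the $2\times2$ minors of the $r\times2$ matrix with columns $\partial$ and $A\partial$. For $0\le e<d$ and $A\in M^f_e$ there is a unique $g\in\mathcal{R}_{d-e}$ with $\partial g=A\,\partial f$; the $K$-linear map $\gamma^f_e:M^f_e\to\mathcal{R}_{d-e}$ sends $A$ to this $g$. *)

theory Defs
  imports "HOL-Analysis.Analysis" "HOL-Library.Poly_Mapping"
begin

text \<open>
  The number of variables is \<open>r = CARD('n)\<close>. Exponents are finitely supported functions
  \<open>'n \<Rightarrow>\<^sub>0 nat\<close>, and polynomials are finitely supported functions on exponents with the
  convolution product of \<^theory>\<open>HOL-Library.Poly_Mapping\<close>: \<open>Poly_Mapping.single \<beta> c\<close> is the
  monomial \<open>c \<partial>\<^sup>\<beta>\<close>.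
\<close>

type_synonym ('n, 'k) diff_poly = "('n \<Rightarrow>\<^sub>0 nat) \<Rightarrow>\<^sub>0 'k"

text \<open>
  Elements of the divided power ring are given by their coordinates in the basis \<open>x\<^sup>(\<^sup>\<alpha>\<^sup>)\<close>, so
  here \<open>Poly_Mapping.single \<alpha> c\<close> stands for \<open>c x\<^sup>(\<^sup>\<alpha>\<^sup>)\<close>. Only the graded vector space structure
  and the action of the polynomial ring are used below. The product \<open>(*)\<close> of this
  representation is \<^emph>\<open>not\<close> the divided power product and is never applied to such elements.
\<close>

type_synonym ('n, 'k) div_pow = "('n \<Rightarrow>\<^sub>0 nat) \<Rightarrow>\<^sub>0 'k"

definition total_deg :: "('n::finite \<Rightarrow>\<^sub>0 nat) \<Rightarrow> nat" where
  "total_deg \<alpha> = (\<Sum>i\<in>UNIV. Poly_Mapping.lookup \<alpha> i)"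

text \<open>Both \<open>R\<^sub>e\<close> and \<open>\<R>\<^sub>e\<close>; the zero element is in every graded piece.\<close>

definition homog :: "nat \<Rightarrow> (('n::finite \<Rightarrow>\<^sub>0 nat) \<Rightarrow>\<^sub>0 'k::zero) set" where
  "homog e = {p. \<forall>\<alpha>\<in>Poly_Mapping.keys p. total_deg \<alpha> = e}"

text \<open>The bilinear extension of \<open>\<partial>\<^sup>\<beta> x\<^sup>(\<^sup>\<alpha>\<^sup>) = x\<^sup>(\<^sup>\<alpha>\<^sup>-\<^sup>\<beta>\<^sup>)\<close>, which is zero unless \<open>\<beta> \<le> \<alpha>\<close> entrywise.\<close>

definition act :: "('n::finite, 'k::field) diff_poly \<Rightarrow> ('n, 'k) div_pow \<Rightarrow> ('n, 'k) div_pow" where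
  "act D f = (\<Sum>\<beta>\<in>Poly_Mapping.keys D. \<Sum>\<alpha>\<in>Poly_Mapping.keys f.
     if \<forall>i. Poly_Mapping.lookup \<beta> i \<le> Poly_Mapping.lookup \<alpha> i
     then Poly_Mapping.single (\<alpha> - \<beta>) (Poly_Mapping.lookup D \<beta> * Poly_Mapping.lookup f \<alpha>)
     else 0)"

definition ann :: "('n::finite, 'k::field) div_pow \<Rightarrow> ('n, 'k) diff_poly set" where
  "ann f = {D. act D f = 0}"

definition partials :: "('n::finite, 'k::field) diff_poly ^ 'n" where
  "partials = (\<chi> i. Poly_Mapping.single (Poly_Mapping.single i 1) 1)"

definition col_act ::
    "('n::finite, 'k::field) diff_poly ^ 'n \<Rightarrow> ('n, 'k) div_pow \<Rightarrow> ('n, 'k) div_pow ^ 'n" where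
  "col_act v f = (\<chi> i. act (v $ i) f)"

definition Mat_homog :: "nat \<Rightarrow> (('n::finite, 'k::field) diff_poly ^ 'n ^ 'n) set" where
  "Mat_homog e = {A. \<forall>i j. A $ i $ j \<in> homog e}"

text \<open>
  The ideal of \<open>2 \<times> 2\<close> minors of the \<open>r \<times> 2\<close> matrix with columns \<open>u\<close> and \<open>v\<close>. A commutative
  ring is a module over itself with scalar multiplication \<open>(*)\<close>, and the span of a set in this
  module is the ideal that it generates.
\<close>

definition I2 ::
    "('n::finite, 'k::field) diff_poly ^ 'n \<Rightarrow> ('n, 'k) diff_poly ^ 'n \<Rightarrow> ('n, 'k) diff_poly set" where
  "I2 u v = module.span (*)
     {det (vector [vector [u $ i, v $ i], vector [u $ j, v $ j]] :: ('n, 'k) diff_poly ^ 2 ^ 2)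
        | i j. i \<noteq> j}"

definition M ::
    "('n::finite, 'k::field) div_pow \<Rightarrow> nat \<Rightarrow> (('n, 'k) diff_poly ^ 'n ^ 'n) set" where
  "M f e = {A \<in> Mat_homog e. I2 partials (A *v partials) \<subseteq> ann f}"

text \<open>
  \<open>d\<close> is a parameter because \<open>f = 0\<close> does not determine it. The description is meaningful for
  \<open>f \<in> homog d\<close>, \<open>e < d\<close> and \<open>A \<in> M f e\<close>, where exactly one such \<open>g\<close> exists.
\<close>

definition gamma ::
    "nat \<Rightarrow> ('n::finite, 'k::field) div_pow \<Rightarrow> nat \<Rightarrow> ('n, 'k) diff_poly ^ 'n ^ 'n
      \<Rightarrow> ('n, 'k) div_pow" where
  "gamma d f e A =
     (THE g. g \<in> homog (d - e) \<and> col_act partials g = col_act (A *v partials) f)"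

definition ker_gamma ::
    "nat \<Rightarrow> ('n::finite, 'k::field) div_pow \<Rightarrow> nat \<Rightarrow> (('n, 'k) diff_poly ^ 'n ^ 'n) set" where
  "ker_gamma d f e = {A \<in> M f e. gamma d f e A = 0}"

definition mat_scale ::
    "'k::field \<Rightarrow> ('n::finite, 'k) diff_poly ^ 'n ^ 'n \<Rightarrow> ('n, 'k) diff_poly ^ 'n ^ 'n" where
  "mat_scale c A = (\<chi> i j. Poly_Mapping.single 0 c * A $ i $ j)"

text \<open>The condition is \<open>e \<le> d - 3\<close> with subtraction in the integers.\<close>

definition M_hat_part ::
    "nat \<Rightarrow> ('n::finite, 'k::field) div_pow \<Rightarrow> nat \<Rightarrow> (('n, 'k) diff_poly ^ 'n ^ 'n) set" where
  "M_hat_part d f e = (if e + 3 \<le> d then M f e else Mat_homog e)"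

text \<open>
  The sum of subspaces \<open>G e\<close> of one ambient space: all finite sums of elements of them. That such
  a sum is direct is part of \<open>graded_algebra\<close> below.
\<close>

definition graded_sum :: "(nat \<Rightarrow> 'b::comm_monoid_add set) \<Rightarrow> 'b set" where
  "graded_sum G = {x. \<exists>c. (\<forall>e. c e \<in> G e) \<and> finite {e. c e \<noteq> 0} \<and> x = (\<Sum>e | c e \<noteq> 0. c e)}"

definition M_hat ::
    "nat \<Rightarrow> ('n::finite, 'k::field) div_pow \<Rightarrow> (('n, 'k) diff_poly ^ 'n ^ 'n) set" where
  "M_hat d f = graded_sum (M_hat_part d f)"

text \<open>
  An associative, not necessarily commutative algebra with unity over a field, graded by the
  natural numbers. Its underlying vector space is a subspace \<open>S\<close> of an ambient vector space, the
  multiplication needs to satisfy the axioms on \<open>S\<close> only, and \<open>G e\<close> is the piece of degree \<open>e\<close>.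
\<close>

locale graded_algebra = vector_space scale
  for scale :: "'k::field \<Rightarrow> 'b::ab_group_add \<Rightarrow> 'b" +
  fixes mult :: "'b \<Rightarrow> 'b \<Rightarrow> 'b" and unity :: 'b and S :: "'b set" and G :: "nat \<Rightarrow> 'b set"
  assumes carrier_subspace: "subspace S"
    and mult_closed: "x \<in> S \<Longrightarrow> y \<in> S \<Longrightarrow> mult x y \<in> S"
    and mult_assoc: "x \<in> S \<Longrightarrow> y \<in> S \<Longrightarrow> z \<in> S \<Longrightarrow> mult (mult x y) z = mult x (mult y z)"
    and mult_add_left: "x \<in> S \<Longrightarrow> y \<in> S \<Longrightarrow> z \<in> S \<Longrightarrow> mult (x + y) z = mult x z + mult y z"
    and mult_add_right: "x \<in> S \<Longrightarrow> y \<in> S \<Longrightarrow> z \<in> S \<Longrightarrow> mult x (y + z) = mult x y + mult x z"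
    and mult_scale_left: "x \<in> S \<Longrightarrow> y \<in> S \<Longrightarrow> mult (scale c x) y = scale c (mult x y)"
    and mult_scale_right: "x \<in> S \<Longrightarrow> y \<in> S \<Longrightarrow> mult x (scale c y) = scale c (mult x y)"
    and unity_closed: "unity \<in> S"
    and unity_left: "x \<in> S \<Longrightarrow> mult unity x = x"
    and unity_right: "x \<in> S \<Longrightarrow> mult x unity = x"
    and part_subspace: "subspace (G e)"
    and part_subset: "G e \<subseteq> S"
    and direct_sum: "x \<in> S \<Longrightarrow>
      \<exists>!c. (\<forall>e. c e \<in> G e) \<and> finite {e. c e \<noteq> 0} \<and> x = (\<Sum>e | c e \<noteq> 0. c e)"
    and part_mult: "x \<in> G i \<Longrightarrow> y \<in> G j \<Longrightarrow> mult x y \<in> G (i + j)"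
    and unity_degree: "unity \<in> G 0"

end

theory Submission
  imports Defs
begin

text \<open>
  Matrices in \<open>M f e\<close> behave like operators on potentials. The minors of \<open>\<partial>\<close> and \<open>A\<partial>\<close>
  annihilate \<open>f\<close> exactly if the vector \<open>A\<partial>f\<close> is closed, that is
  \<open>\<partial>\<^sub>i (A\<partial>)\<^sub>j f = \<partial>\<^sub>j (A\<partial>)\<^sub>i f\<close> for all \<open>i\<close> and \<open>j\<close> (\<open>M_iff\<close>). A closed vector is the vector
  of partials of some \<open>g\<close> (\<open>closed_imp_exact\<close>), and an element of positive degree whose partials
  all vanish is zero (\<open>partials_zero_imp_zero\<close>). Both hold in every characteristic because a
  partial just shifts the coefficients in the basis of divided powers.

  Let \<open>B \<in> M f b\<close> have the potential \<open>g\<close>, so \<open>\<partial>g = B\<partial>f\<close> and hence \<open>AB\<partial>f = A\<partial>g\<close>. For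
  \<open>A \<in> M f a\<close>, a minor \<open>P\<close> of \<open>\<partial>\<close> and \<open>A\<partial>\<close> annihilates \<open>f\<close>, hence also every \<open>(B\<partial>)\<^sub>k f = \<partial>\<^sub>k g\<close>.
  So the partials of \<open>P g\<close> vanish, and \<open>P g = 0\<close> because its degree \<open>d - a - b - 2\<close> is positive.
  This means \<open>A \<in> M g a\<close> (\<open>M_transfer_gamma\<close>), so \<open>A\<partial>g = AB\<partial>f\<close> is closed and
  \<open>AB \<in> M f (a + b)\<close>.

  For the commutator, the same potential gives
  \<open>\<partial>\<^sub>k (AB\<partial>)\<^sub>i f = (A\<partial>)\<^sub>i \<partial>\<^sub>k g = (A\<partial>)\<^sub>i (B\<partial>)\<^sub>k f\<close>. Because \<open>AB\<partial>f\<close> is closed, \<open>i\<close> and \<open>k\<close> may be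
  exchanged in this expression, which amounts to exchanging \<open>A\<close> and \<open>B\<close>. So all partials of
  \<open>(AB - BA)\<partial>f\<close> vanish, and this vector is zero for degree reasons (\<open>commutator_annihilates\<close>).

  For the graded algebra it remains that the pieces are subspaces of the homogeneous matrices,
  whose sum is direct. Beyond degree \<open>d - 3\<close> the pieces contain all homogeneous matrices, so
  closure under multiplication is automatic there.
\<close>

section \<open>Homogeneous elements\<close>

lemma total_deg_plus: "total_deg (\<alpha> + \<beta>) = total_deg \<alpha> + total_deg \<beta>"
  by (simp add: total_deg_def lookup_add sum.distrib)

lemma total_deg_single: "total_deg (Poly_Mapping.single i n) = n"
  by (simp add: total_deg_def lookup_single when_def)

lemma homog_iff: "p \<in> homog e \<longleftrightarrow> (\<forall>\<alpha>. total_deg \<alpha> \<noteq> e \<longrightarrow> Poly_Mapping.lookup p \<alpha> = 0)"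
  unfolding homog_def by (auto simp: in_keys_iff)

lemma homog_zero: "0 \<in> homog e"
  by (simp add: homog_iff)

lemma homog_add: "p \<in> homog e \<Longrightarrow> q \<in> homog e \<Longrightarrow> p + q \<in> homog e"
  by (simp add: homog_iff lookup_add)

lemma homog_sum: "(\<And>x. x \<in> X \<Longrightarrow> p x \<in> homog e) \<Longrightarrow> sum p X \<in> homog e"
  by (simp add: homog_iff lookup_sum)

lemma homog_mult: "p \<in> homog a \<Longrightarrow> q \<in> homog b \<Longrightarrow> p * q \<in> homog (a + b)"
  unfolding homog_def using keys_mult[of p q] by (fastforce simp: total_deg_plus)

lemma constant_homog: "Poly_Mapping.single 0 c \<in> homog 0"
  by (simp add: homog_def total_deg_def)

lemma partials_homog: "partials $ i \<in> homog 1"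
  by (simp add: partials_def homog_def total_deg_single)


section \<open>The action by contraction\<close>

text \<open>
  Reading off coefficients removes the case distinction in the action: the only exponent that
  \<open>\<partial>\<^sup>\<beta>\<close> moves to \<open>\<gamma>\<close> is \<open>\<gamma> + \<beta>\<close>, and this one always dominates \<open>\<beta>\<close>.
\<close>

lemma lookup_act:
  "Poly_Mapping.lookup (act D f) \<gamma> =
     (\<Sum>\<beta>\<in>Poly_Mapping.keys D. Poly_Mapping.lookup D \<beta> * Poly_Mapping.lookup f (\<gamma> + \<beta>))"
proof -
  have dominated: "(\<forall>i. Poly_Mapping.lookup \<beta> i \<le> Poly_Mapping.lookup \<alpha> i) \<and> \<alpha> - \<beta> = \<gamma>
      \<longleftrightarrow> \<alpha> = \<gamma> + \<beta>" for \<alpha> \<beta>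
    by (auto simp: poly_mapping_eq_iff lookup_add lookup_minus fun_eq_iff) (metis le_add_diff_inverse2)
  have "Poly_Mapping.lookup (act D f) \<gamma> =
    (\<Sum>\<beta>\<in>Poly_Mapping.keys D. \<Sum>\<alpha>\<in>Poly_Mapping.keys f.
       if \<alpha> = \<gamma> + \<beta> then Poly_Mapping.lookup D \<beta> * Poly_Mapping.lookup f \<alpha> else 0)"
    unfolding act_def lookup_sum
    by (intro sum.cong refl) (auto simp: lookup_single when_def dominated[symmetric])
  also have "\<dots> = (\<Sum>\<beta>\<in>Poly_Mapping.keys D.
      Poly_Mapping.lookup D \<beta> * Poly_Mapping.lookup f (\<gamma> + \<beta>))"
    by (intro sum.cong refl) (auto simp: sum.delta' in_keys_iff)
  finally show ?thesis .
qed

lemma lookup_act_superset: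
  assumes "finite X" "Poly_Mapping.keys D \<subseteq> X"
  shows "Poly_Mapping.lookup (act D f) \<gamma> =
     (\<Sum>\<beta>\<in>X. Poly_Mapping.lookup D \<beta> * Poly_Mapping.lookup f (\<gamma> + \<beta>))"
  unfolding lookup_act using assms
  by (intro sum.mono_neutral_left) (auto simp: in_keys_iff)

lemma act_add_left: "act (D + E) f = act D f + act E f"
proof (rule poly_mapping_eqI)
  fix \<gamma>
  let ?X = "Poly_Mapping.keys D \<union> Poly_Mapping.keys E"
  have "Poly_Mapping.keys (D + E) \<subseteq> ?X"
    by (rule keys_add)
  then show "Poly_Mapping.lookup (act (D + E) f) \<gamma> = Poly_Mapping.lookup (act D f + act E f) \<gamma>"
    by (simp add: lookup_act_superset[of ?X] lookup_add distrib_right sum.distrib)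
qed

lemma act_add_right: "act D (f + g) = act D f + act D g"
  by (rule poly_mapping_eqI) (simp add: lookup_act lookup_add distrib_left sum.distrib)

lemma act_zero_left [simp]: "act 0 f = 0"
  by (simp add: act_def)

lemma act_zero_right [simp]: "act D 0 = 0"
  by (simp add: act_def)

lemma act_diff_left: "act (D - E) f = act D f - act E f"
  using act_add_left[of "D - E" E f] by simp

lemma act_diff_right: "act D (f - g) = act D f - act D g"
  using act_add_right[of D "f - g" g] by simp

lemma act_sum_left: "act (sum D X) f = (\<Sum>x\<in>X. act (D x) f)"
  by (induction X rule: infinite_finite_induct) (simp_all add: act_add_left)

lemma lookup_act_single:
  "Poly_Mapping.lookup (act (Poly_Mapping.single \<beta> c) f) \<gamma> = c * Poly_Mapping.lookup f (\<gamma> + \<beta>)"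
  by (simp add: lookup_act)

text \<open>Every claim that is additive in a polynomial needs a proof for monomials only.\<close>

lemma poly_mapping_additive_induct [case_names add single]:
  assumes "\<And>p q. P p \<Longrightarrow> P q \<Longrightarrow> P (p + q)" and "\<And>\<beta> c. P (Poly_Mapping.single \<beta> c)"
  shows "P p"
proof (induction p rule: update_induct)
  case const
  show ?case using assms(2)[of undefined 0] by simp
next
  case (update p a b)
  have "Poly_Mapping.update a b p = p + Poly_Mapping.single a b"
    using update(1)
    by (intro poly_mapping_eqI)
      (auto simp: lookup_update lookup_add lookup_single when_def in_keys_iff)
  then show ?case
    using assms update by simp
qed

lemma act_mult: "act (D * E) f = act D (act E f)"
proof (induction D rule: poly_mapping_additive_induct)
  case (add D D')
  then show ?case by (simp add: distrib_right act_add_left)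
next
  case (single \<beta> c)
  show ?case
  proof (induction E rule: poly_mapping_additive_induct)
    case (add E E')
    then show ?case by (simp add: distrib_left act_add_left act_add_right)
  next
    case (single \<beta>' c')
    show ?case
      by (rule poly_mapping_eqI) (simp add: mult_single lookup_act_single add.assoc)
  qed
qed

lemma act_commute: "act D (act E f) = act E (act D f)"
  by (simp add: act_mult[symmetric] mult.commute)

text \<open>
  If \<open>e > d\<close>, then \<open>act D f = 0\<close>, so the conclusion also holds with truncated subtraction.
\<close>

lemma act_homog:
  assumes "D \<in> homog e" "f \<in> homog d"
  shows "act D f \<in> homog (d - e)"
proof -
  have "Poly_Mapping.lookup D \<beta> * Poly_Mapping.lookup f (\<gamma> + \<beta>) = 0"
    if "total_deg \<gamma> \<noteq> d - e" for \<beta> \<gamma>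
    using assms that unfolding homog_iff by (cases "total_deg \<beta> = e") (auto simp: total_deg_plus)
  then show ?thesis
    unfolding homog_iff lookup_act by (intro allI impI sum.neutral ballI)
qed

lemma lookup_act_partial:
  "Poly_Mapping.lookup (act (partials $ i) f) \<gamma> = Poly_Mapping.lookup f (\<gamma> + Poly_Mapping.single i 1)"
  by (simp add: partials_def lookup_act_single)

lemma exponent_nonzero_decompose:
  fixes \<alpha> :: "'n::finite \<Rightarrow>\<^sub>0 nat"
  assumes "\<alpha> \<noteq> 0"
  obtains i \<gamma> where "\<alpha> = \<gamma> + Poly_Mapping.single i 1"
proof -
  from assms obtain i where "Poly_Mapping.lookup \<alpha> i \<noteq> 0"
    by (metis lookup_zero poly_mapping_eqI)
  then have "\<alpha> = (\<alpha> - Poly_Mapping.single i 1) + Poly_Mapping.single i 1"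
    by (intro poly_mapping_eqI) (auto simp: lookup_add lookup_minus lookup_single when_def)
  then show thesis by (rule that)
qed

text \<open>
  In positive degree every exponent has the form \<open>\<gamma> + e\<^sub>i\<close>, and its coefficient is a coefficient
  of the \<open>i\<close>-th partial.
\<close>

lemma partials_zero_imp_zero:
  assumes "g \<in> homog e" "e > 0" "\<And>i. act (partials $ i) g = 0"
  shows "g = 0"
proof (rule poly_mapping_eqI)
  fix \<alpha>
  show "Poly_Mapping.lookup g \<alpha> = Poly_Mapping.lookup 0 \<alpha>"
  proof (cases "\<alpha> = 0")
    case True
    then show ?thesis using assms(1,2) by (auto simp: homog_iff total_deg_def)
  next
    case False
    then obtain i \<gamma> where "\<alpha> = \<gamma> + Poly_Mapping.single i 1"
      by (rule exponent_nonzero_decompose)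
    then show ?thesis
      using lookup_act_partial[of i g \<gamma>] assms(3)[of i] by simp
  qed
qed

text \<open>
  The Poincare lemma for contraction: closed forms are exact. The coefficient of \<open>g\<close> at
  \<open>\<gamma> + e\<^sub>i\<close> has to be that of \<open>h\<^sub>i\<close> at \<open>\<gamma>\<close>; the closedness condition says that all ways of
  splitting an exponent in this form give the same value.
\<close>

lemma closed_imp_exact:
  fixes h :: "'n::finite \<Rightarrow> ('n, 'k::field) div_pow"
  assumes closed: "\<And>i j. act (partials $ i) (h j) = act (partials $ j) (h i)"
    and homog: "\<And>i. h i \<in> homog n"
  obtains g where "g \<in> homog (n + 1)" "\<And>i. act (partials $ i) g = h i"
proof -
  let ?e = "\<lambda>i. Poly_Mapping.single i (1::nat)"
  \<comment> \<open>Two different splittings of one exponent have a common part \<open>\<epsilon>\<close>, and closedness at \<open>\<epsilon>\<close>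
    compares their values.\<close>
  have well_defined: "Poly_Mapping.lookup (h i) \<gamma> = Poly_Mapping.lookup (h j) \<delta>"
    if eq: "\<gamma> + ?e i = \<delta> + ?e j" for i j \<gamma> \<delta>
  proof (cases "i = j")
    case True
    then show ?thesis using eq by simp
  next
    case False
    define \<epsilon> where "\<epsilon> = \<gamma> - ?e j"
    have \<gamma>: "\<gamma> = \<epsilon> + ?e j"
    proof (rule poly_mapping_eqI)
      fix k
      have "Poly_Mapping.lookup (\<gamma> + ?e i) k = Poly_Mapping.lookup (\<delta> + ?e j) k"
        by (simp only: eq)
      then show "Poly_Mapping.lookup \<gamma> k = Poly_Mapping.lookup (\<epsilon> + ?e j) k"
        using False by (auto simp: \<epsilon>_def lookup_add lookup_minus lookup_single when_def split: if_splits)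
    qed
    have "\<delta> + ?e j = \<epsilon> + ?e i + ?e j"
      using eq by (simp add: \<gamma> ac_simps)
    then have \<delta>: "\<delta> = \<epsilon> + ?e i" by simp
    show ?thesis
      using lookup_act_partial[of j "h i" \<epsilon>] lookup_act_partial[of i "h j" \<epsilon>] closed[of i j]
      by (simp add: \<gamma> \<delta>)
  qed
  \<comment> \<open>No splitting exists at \<open>\<alpha> = 0\<close>; the value there is forced by homogeneity.\<close>
  define c where "c \<alpha> = (if \<alpha> = 0 then 0 else
      (THE x. \<exists>i \<gamma>. \<alpha> = \<gamma> + ?e i \<and> x = Poly_Mapping.lookup (h i) \<gamma>))" for \<alpha>
  have e_nonzero: "\<gamma> + ?e i \<noteq> 0" for \<gamma> i
    by (metis One_nat_def add_is_0 lookup_add lookup_single_eq lookup_zero nat.simps(3))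
  have c: "c (\<gamma> + ?e i) = Poly_Mapping.lookup (h i) \<gamma>" for \<gamma> i
  proof -
    have "(THE x. \<exists>j \<delta>. \<gamma> + ?e i = \<delta> + ?e j \<and> x = Poly_Mapping.lookup (h j) \<delta>)
        = Poly_Mapping.lookup (h i) \<gamma>"
      by (rule the_equality) (use well_defined in metis)+
    then show ?thesis using e_nonzero[of \<gamma> i] by (simp add: c_def del: One_nat_def)
  qed
  have "finite {\<alpha>. c \<alpha> \<noteq> 0}"
  proof (rule finite_subset)
    show "finite (\<Union>i. (\<lambda>\<gamma>. \<gamma> + ?e i) ` Poly_Mapping.keys (h i))" by simp
    show "{\<alpha>. c \<alpha> \<noteq> 0} \<subseteq> (\<Union>i. (\<lambda>\<gamma>. \<gamma> + ?e i) ` Poly_Mapping.keys (h i))"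
    proof
      fix \<alpha>
      assume "\<alpha> \<in> {\<alpha>. c \<alpha> \<noteq> 0}"
      then have nz: "c \<alpha> \<noteq> 0" by simp
      then have "\<alpha> \<noteq> 0" by (auto simp: c_def)
      then obtain i \<gamma> where "\<alpha> = \<gamma> + ?e i" by (rule exponent_nonzero_decompose)
      with nz have "\<gamma> \<in> Poly_Mapping.keys (h i)"
        by (simp add: c in_keys_iff del: One_nat_def)
      with \<open>\<alpha> = \<gamma> + ?e i\<close> show "\<alpha> \<in> (\<Union>i. (\<lambda>\<gamma>. \<gamma> + ?e i) ` Poly_Mapping.keys (h i))"
        by blast
    qed
  qed
  then have lookup: "Poly_Mapping.lookup (Abs_poly_mapping c) = c" by simp
  show thesis
  proof
    show "act (partials $ i) (Abs_poly_mapping c) = h i" for i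
      by (rule poly_mapping_eqI) (simp add: lookup_act_partial lookup c del: One_nat_def)
    show "Abs_poly_mapping c \<in> homog (n + 1)"
      unfolding homog_iff lookup
    proof (intro allI impI)
      fix \<alpha> :: "'n \<Rightarrow>\<^sub>0 nat"
      assume deg: "total_deg \<alpha> \<noteq> n + 1"
      show "c \<alpha> = 0"
      proof (cases "\<alpha> = 0")
        case True
        then show ?thesis by (simp add: c_def)
      next
        case False
        then obtain i \<gamma> where \<alpha>: "\<alpha> = \<gamma> + ?e i" by (rule exponent_nonzero_decompose)
        then have "total_deg \<gamma> \<noteq> n" using deg by (simp add: total_deg_plus total_deg_single)
        then show ?thesis using homog[of i] by (simp add: \<alpha> c homog_iff del: One_nat_def)
      qed
    qed
  qed
qed


section \<open>Matrices with minors annihilating f\<close>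

lemma ring_module: "module ((*) :: 'a::comm_ring_1 \<Rightarrow> 'a \<Rightarrow> 'a)"
  by unfold_locales (simp_all add: algebra_simps)

lemma ann_ideal: "module.subspace (*) (ann f)"
  by (rule module.subspaceI[OF ring_module]) (simp_all add: ann_def act_add_left act_mult)

lemma minor_eq:
  "det (vector [vector [a, b], vector [c, d]] :: 'a::comm_ring_1 ^ 2 ^ 2) = a * d - b * c"
  by (simp add: det_2)

text \<open>
  Annihilating the minors means that the vector \<open>A\<partial>f\<close> passes the closedness test
  \<open>\<partial>\<^sub>i (A\<partial>f)\<^sub>j = \<partial>\<^sub>j (A\<partial>f)\<^sub>i\<close> for being a vector of partials.
\<close>

lemma M_iff:
  "A \<in> M f e \<longleftrightarrow> A \<in> Mat_homog e \<and>
     (\<forall>i j. act (partials $ i) (act ((A *v partials) $ j) f)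
          = act (partials $ j) (act ((A *v partials) $ i) f))"
proof -
  let ?minor = "\<lambda>i j. partials $ i * (A *v partials) $ j - (A *v partials) $ i * partials $ j"
  have minors: "I2 partials (A *v partials) = module.span (*) {?minor i j | i j. i \<noteq> j}"
    unfolding I2_def minor_eq ..
  have "I2 partials (A *v partials) \<subseteq> ann f \<longleftrightarrow> {?minor i j | i j. i \<noteq> j} \<subseteq> ann f"
    unfolding minors
  proof
    assume "{?minor i j | i j. i \<noteq> j} \<subseteq> ann f"
    then show "module.span (*) {?minor i j | i j. i \<noteq> j} \<subseteq> ann f"
      by (rule module.span_minimal[OF ring_module _ ann_ideal])
  qed (rule order_trans[OF module.span_superset[OF ring_module]])
  also have "\<dots> \<longleftrightarrow> (\<forall>i j. i \<noteq> j \<longrightarrow> ?minor i j \<in> ann f)"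
    by blast
  also have "\<dots> \<longleftrightarrow> (\<forall>i j. i \<noteq> j \<longrightarrow> act (partials $ i) (act ((A *v partials) $ j) f)
          = act (partials $ j) (act ((A *v partials) $ i) f))"
    by (simp add: ann_def act_diff_left act_mult act_commute[of "(A *v partials) $ _"])
  also have "\<dots> \<longleftrightarrow> (\<forall>i j. act (partials $ i) (act ((A *v partials) $ j) f)
          = act (partials $ j) (act ((A *v partials) $ i) f))"
    by metis
  finally show ?thesis by (simp add: M_def)
qed

lemma M_closed:
  "A \<in> M f e \<Longrightarrow> act (partials $ i) (act ((A *v partials) $ j) f)
     = act (partials $ j) (act ((A *v partials) $ i) f)"
  by (simp add: M_iff)

lemma M_subset_Mat_homog: "M f e \<subseteq> Mat_homog e"
  by (auto simp: M_def)

lemma Mat_homog_mult: "A \<in> Mat_homog a \<Longrightarrow> B \<in> Mat_homog b \<Longrightarrow> A ** B \<in> Mat_homog (a + b)"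
  by (auto simp: Mat_homog_def matrix_matrix_mult_def intro!: homog_sum homog_mult)

lemma Mat_homog_partials: "A \<in> Mat_homog e \<Longrightarrow> (A *v partials) $ i \<in> homog (e + 1)"
  by (auto simp: Mat_homog_def matrix_vector_mult_def simp del: One_nat_def add_Suc_right
      intro!: homog_sum homog_mult partials_homog)

text \<open>
  The action on columns is compatible with multiplication of matrices, so \<open>\<partial>g = B\<partial>f\<close> gives
  \<open>A\<partial>g = AB\<partial>f\<close>.
\<close>

lemma col_act_matrix_cong:
  assumes "col_act v f = col_act w g"
  shows "col_act (A *v v) f = col_act (A *v w) g"
proof -
  have "act (v $ k) f = act (w $ k) g" for k
    using assms by (simp add: col_act_def vec_eq_iff)
  then show ?thesis
    by (simp add: col_act_def matrix_vector_mult_def vec_eq_iff act_sum_left act_mult)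
qed

lemma gamma_exists:
  assumes "f \<in> homog d" "e < d" "A \<in> M f e"
  obtains g where "g \<in> homog (d - e)" "col_act partials g = col_act (A *v partials) f"
proof -
  have "act ((A *v partials) $ i) f \<in> homog (d - (e + 1))" for i
    using assms M_subset_Mat_homog by (intro act_homog Mat_homog_partials) auto
  then obtain g where g: "g \<in> homog (d - (e + 1) + 1)"
    "\<And>i. act (partials $ i) g = act ((A *v partials) $ i) f"
    using closed_imp_exact[of "\<lambda>i. act ((A *v partials) $ i) f"] M_closed[OF assms(3)] by metis
  moreover have "d - (e + 1) + 1 = d - e" using assms(2) by simp
  ultimately show thesis using that by (simp add: col_act_def)
qed

text \<open>
  Passing from \<open>f\<close> to \<open>g\<close> preserves minors that annihilate \<open>f\<close>: for such a minor \<open>P\<close>, we get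
  \<open>\<partial>\<^sub>k (P g) = P (B\<partial>)\<^sub>k f = (B\<partial>)\<^sub>k (P f) = 0\<close> for all \<open>k\<close>. The bound on
  \<open>a + b\<close> is dictated by this step: \<open>P g\<close> has degree \<open>d - b - (a + 2)\<close>, and this must be
  positive to conclude that \<open>P g = 0\<close>.
\<close>

lemma M_transfer_gamma:
  assumes A: "A \<in> M f a" and g: "g \<in> homog (d - b)"
    and gB: "col_act partials g = col_act (B *v partials) f" and bound: "a + b + 3 \<le> d"
  shows "A \<in> M g a"
proof -
  have hom: "A \<in> Mat_homog a" using A M_subset_Mat_homog by auto
  have gBk: "act (partials $ k) g = act ((B *v partials) $ k) f" for k
    using gB by (simp add: col_act_def vec_eq_iff)
  have "act (partials $ i) (act ((A *v partials) $ j) g)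
      = act (partials $ j) (act ((A *v partials) $ i) g)" for i j
  proof -
    \<comment> \<open>the minor of rows \<open>i\<close> and \<open>j\<close>\<close>
    define P where "P = partials $ i * (A *v partials) $ j - partials $ j * (A *v partials) $ i"
    have Pf: "act P f = 0"
      using M_closed[OF A] by (simp add: P_def act_diff_left act_mult)
    have zero: "act (partials $ k) (act P g) = 0" for k
    proof -
      have "act (partials $ k) (act P g) = act P (act ((B *v partials) $ k) f)"
        by (subst act_commute) (simp only: gBk)
      also have "\<dots> = act ((B *v partials) $ k) (act P f)"
        by (rule act_commute)
      finally show ?thesis by (simp add: Pf)
    qed
    have "act P g \<in> homog (d - b - (a + 2))"
    proof (rule act_homog[OF _ g])
      have minor: "partials $ k * (A *v partials) $ l \<in> homog (a + 2)" for k l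
        using homog_mult[OF partials_homog Mat_homog_partials[OF hom]] by simp
      show "P \<in> homog (a + 2)"
        using minor[of i j] minor[of j i] by (simp add: P_def homog_iff lookup_minus)
    qed
    then have "act P g = 0"
      by (rule partials_zero_imp_zero) (use bound zero in simp_all)
    then show ?thesis by (simp add: P_def act_diff_left act_mult)
  qed
  then show ?thesis using hom by (simp add: M_iff)
qed

lemma M_mult_closed:
  assumes f: "f \<in> homog d" and bound: "a + b + 3 \<le> d" and A: "A \<in> M f a" and B: "B \<in> M f b"
  shows "A ** B \<in> M f (a + b)"
proof -
  obtain g where g: "g \<in> homog (d - b)" "col_act partials g = col_act (B *v partials) f"
    using gamma_exists[OF f _ B] bound by auto
  have "A \<in> M g a" by (rule M_transfer_gamma[OF A g bound])
  moreover have "act (((A ** B) *v partials) $ i) f = act ((A *v partials) $ i) g" for i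
    using col_act_matrix_cong[OF g(2), of A]
    by (simp add: col_act_def vec_eq_iff matrix_vector_mul_assoc)
  moreover have "A ** B \<in> Mat_homog (a + b)"
    using A B M_subset_Mat_homog by (blast intro: Mat_homog_mult)
  ultimately show ?thesis by (simp add: M_iff)
qed

text \<open>
  With \<open>\<partial>g = B\<partial>f\<close>, the partials of \<open>AB\<partial>f = A\<partial>g\<close> can be computed by moving \<open>\<partial>\<^sub>k\<close> past
  \<open>A\<partial>\<close>. The right-hand side makes the roles of \<open>A\<close> and \<open>B\<close> visible: it is symmetric under
  exchanging both \<open>A, B\<close> and \<open>i, k\<close>.
\<close>

lemma partial_product_action:
  assumes f: "f \<in> homog d" and bound: "a + b + 3 \<le> d" and A: "A \<in> M f a" and B: "B \<in> M f b"
  shows "act (partials $ k) (act (((A ** B) *v partials) $ i) f)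
       = act ((A *v partials) $ i) (act ((B *v partials) $ k) f)"
proof -
  obtain g where g: "g \<in> homog (d - b)" "col_act partials g = col_act (B *v partials) f"
    using gamma_exists[OF f _ B] bound by auto
  have "act (((A ** B) *v partials) $ i) f = act ((A *v partials) $ i) g"
    using col_act_matrix_cong[OF g(2), of A]
    by (simp add: col_act_def vec_eq_iff matrix_vector_mul_assoc)
  moreover have "act (partials $ k) g = act ((B *v partials) $ k) f"
    using g(2) by (simp add: col_act_def vec_eq_iff)
  ultimately show ?thesis by (simp add: act_commute[of "partials $ k"])
qed

text \<open>
  Closedness of \<open>AB\<partial>f\<close> allows to exchange \<open>i\<close> and \<open>k\<close> in \<open>\<partial>\<^sub>k (AB\<partial>f)\<^sub>i\<close>, so by the
  previous lemma it equals \<open>\<partial>\<^sub>k (BA\<partial>f)\<^sub>i\<close>. As the entries of these vectors have positive degree,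
  the vectors themselves agree.
\<close>

lemma commutator_annihilates:
  assumes f: "f \<in> homog d" and bound: "a + b + 3 \<le> d" and A: "A \<in> M f a" and B: "B \<in> M f b"
  shows "col_act ((A ** B - B ** A) *v partials) f = 0"
proof -
  have bound': "b + a + 3 \<le> d" using bound by simp
  have AB: "A ** B \<in> M f (a + b)" by (rule M_mult_closed[OF f bound A B])
  have BA: "B ** A \<in> M f (a + b)"
    using M_mult_closed[OF f bound' B A] by (simp add: add.commute)
  have "act (((A ** B - B ** A) *v partials) $ i) f = 0" for i
  proof (rule partials_zero_imp_zero)
    let ?x = "act (((A ** B) *v partials) $ i) f" and ?y = "act (((B ** A) *v partials) $ i) f"
    have eq: "act (((A ** B - B ** A) *v partials) $ i) f = ?x - ?y"
      by (simp add: matrix_vector_mult_diff_rdistrib act_diff_left)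
    have "act (partials $ k) ?x = act (partials $ k) ?y" for k
    proof -
      have "act (partials $ k) ?x = act (partials $ i) (act (((A ** B) *v partials) $ k) f)"
        by (rule M_closed[OF AB])
      also have "\<dots> = act ((A *v partials) $ k) (act ((B *v partials) $ i) f)"
        by (rule partial_product_action[OF f bound A B])
      also have "\<dots> = act ((B *v partials) $ i) (act ((A *v partials) $ k) f)"
        by (rule act_commute)
      also have "\<dots> = act (partials $ k) ?y"
        by (rule partial_product_action[OF f bound' B A, symmetric])
      finally show ?thesis .
    qed
    then show "act (partials $ k) (act (((A ** B - B ** A) *v partials) $ i) f) = 0" for k
      by (simp add: eq act_diff_right)
    have "?x \<in> homog (d - (a + b + 1))" "?y \<in> homog (d - (a + b + 1))"
      using AB BA M_subset_Mat_homog by (blast intro: act_homog[OF _ f] Mat_homog_partials)+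
    then show "act (((A ** B - B ** A) *v partials) $ i) f \<in> homog (d - (a + b + 1))"
      by (simp add: eq homog_iff lookup_minus)
    show "0 < d - (a + b + 1)" using bound by simp
  qed
  then show ?thesis by (simp add: col_act_def vec_eq_iff)
qed

text \<open>
  The potential that \<open>gamma\<close> describes is unique as its degree \<open>d - e\<close> is positive, so it suffices
  that \<open>0\<close> is one.
\<close>

lemma gamma_eq_zero:
  assumes "e < d" "col_act (A *v partials) f = 0"
  shows "gamma d f e A = 0"
  unfolding gamma_def
proof (rule the_equality)
  show "0 \<in> homog (d - e) \<and> col_act partials 0 = col_act (A *v partials) f"
    by (simp add: homog_zero assms(2)) (simp add: col_act_def vec_eq_iff)
next
  fix g
  assume "g \<in> homog (d - e) \<and> col_act partials g = col_act (A *v partials) f"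
  then show "g = 0"
    using assms by (intro partials_zero_imp_zero[of g "d - e"]) (auto simp: col_act_def vec_eq_iff)
qed


section \<open>The graded algebra\<close>

lemma mat_scale_vector_space:
  "vector_space (mat_scale :: 'k::field \<Rightarrow> ('n::finite, 'k) diff_poly ^ 'n ^ 'n \<Rightarrow> _)"
  by unfold_locales
    (simp_all add: mat_scale_def vec_eq_iff distrib_left distrib_right single_add
      mult.assoc[symmetric] mult_single)

interpretation mat: vector_space
  "mat_scale :: 'k::field \<Rightarrow> ('n::finite, 'k) diff_poly ^ 'n ^ 'n \<Rightarrow> _"
  by (rule mat_scale_vector_space)

lemma mat_scale_mult_left: "mat_scale c A ** B = mat_scale c (A ** B)"
  by (simp add: mat_scale_def matrix_matrix_mult_def vec_eq_iff sum_distrib_left mult.assoc)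

lemma mat_scale_mult_right: "A ** mat_scale c B = mat_scale c (A ** B)"
  by (simp add: mat_scale_def matrix_matrix_mult_def vec_eq_iff sum_distrib_left mult.left_commute)

lemma mat_scale_mult_vector: "(mat_scale c A *v v) $ i = Poly_Mapping.single 0 c * (A *v v) $ i"
  by (simp add: mat_scale_def matrix_vector_mult_def sum_distrib_left mult.assoc)

lemma Mat_homog_subspace: "mat.subspace (Mat_homog e)"
  by (intro mat.subspaceI)
    (auto simp: Mat_homog_def mat_scale_def homog_zero homog_add
      dest: homog_mult[OF constant_homog, simplified])

lemma M_subspace: "mat.subspace (M f e)"
proof (rule mat.subspaceI)
  show "0 \<in> M f e"
    using mat.subspace_0[OF Mat_homog_subspace] by (simp add: M_iff)
  show "A + B \<in> M f e" if "A \<in> M f e" "B \<in> M f e" for A B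
    using that by (simp add: M_iff matrix_vector_mult_add_rdistrib act_add_left act_add_right
        mat.subspace_add[OF Mat_homog_subspace])
  show "mat_scale c A \<in> M f e" if "A \<in> M f e" for c A
    using that by (simp add: M_iff mat_scale_mult_vector act_mult
        act_commute[of "partials $ _" "Poly_Mapping.single 0 c"]
        mat.subspace_scale[OF Mat_homog_subspace])
qed

lemma commutator_in_ker_gamma:
  assumes f: "f \<in> homog d" and bound: "a + b + 3 \<le> d" and A: "A \<in> M f a" and B: "B \<in> M f b"
  shows "A ** B - B ** A \<in> ker_gamma d f (a + b)"
proof -
  have "B ** A \<in> M f (a + b)"
    using M_mult_closed[OF f _ B A] bound by (simp add: add.commute)
  then have "A ** B - B ** A \<in> M f (a + b)"
    using M_mult_closed[OF f bound A B] by (intro mat.subspace_diff[OF M_subspace])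
  then show ?thesis
    using gamma_eq_zero[OF _ commutator_annihilates[OF f bound A B]] bound
    by (simp add: ker_gamma_def)
qed

lemma M_hat_part_subspace: "mat.subspace (M_hat_part d f e)"
  by (simp add: M_hat_part_def M_subspace Mat_homog_subspace)

lemma M_hat_part_subset_Mat_homog: "M_hat_part d f e \<subseteq> Mat_homog e"
  using M_subset_Mat_homog by (auto simp: M_hat_part_def)

text \<open>
  This is the purpose of the augmentation: products whose degree exceeds \<open>d - 3\<close> may fail to lie in
  \<open>M f (a + b)\<close>, but they only have to be homogeneous.
\<close>

lemma M_hat_part_mult:
  assumes f: "f \<in> homog d" and "A \<in> M_hat_part d f a" "B \<in> M_hat_part d f b"
  shows "A ** B \<in> M_hat_part d f (a + b)"
proof (cases "a + b + 3 \<le> d")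
  case True
  then show ?thesis using assms M_mult_closed[OF f True] by (simp add: M_hat_part_def)
next
  case False
  then show ?thesis
    using assms M_hat_part_subset_Mat_homog Mat_homog_mult by (simp add: M_hat_part_def) blast
qed

lemma one_in_M: "mat 1 \<in> M f 0"
proof -
  have "mat 1 \<in> Mat_homog 0"
    by (auto simp: Mat_homog_def mat_def homog_def total_deg_def)
  then show ?thesis by (simp add: M_iff act_commute)
qed

lemma one_in_M_hat_part: "mat 1 \<in> M_hat_part d f 0"
  using one_in_M M_subset_Mat_homog by (auto simp: M_hat_part_def)

lemma (in module) sum_in_graded_sum:
  assumes "\<And>e. subspace (G e)" "\<And>e. e \<in> F \<Longrightarrow> c e \<in> G e" "finite F"
  shows "(\<Sum>e\<in>F. c e) \<in> graded_sum G"
proof -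
  let ?c = "\<lambda>e. if e \<in> F then c e else 0"
  have supp: "{e. ?c e \<noteq> 0} \<subseteq> F" by auto
  have "(\<Sum>e\<in>F. c e) = (\<Sum>e | ?c e \<noteq> 0. ?c e)"
    using assms(3) by (intro sum.mono_neutral_cong_right) auto
  moreover have "?c e \<in> G e" for e
    using assms(1,2) subspace_0 by simp
  ultimately show ?thesis
    unfolding graded_sum_def mem_Collect_eq using finite_subset[OF supp assms(3)]
    by (intro exI[of _ ?c]) (simp only: simp_thms)
qed

lemma graded_sumE:
  assumes "x \<in> graded_sum G"
  obtains c F where "\<And>e. c e \<in> G e" "finite F" "\<And>e. e \<notin> F \<Longrightarrow> c e = 0" "x = (\<Sum>e\<in>F. c e)"
  using assms unfolding graded_sum_def by auto

lemma (in module) graded_sum_subspace: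
  assumes G: "\<And>e. subspace (G e)"
  shows "subspace (graded_sum G)"
proof (rule subspaceI)
  show "0 \<in> graded_sum G"
    using sum_in_graded_sum[of G "{}"] G by simp
next
  fix x y assume "x \<in> graded_sum G" "y \<in> graded_sum G"
  then obtain c F c' F' where x: "\<And>e. c e \<in> G e" "finite F" "\<And>e. e \<notin> F \<Longrightarrow> c e = 0" "x = (\<Sum>e\<in>F. c e)"
    and y: "\<And>e. c' e \<in> G e" "finite F'" "\<And>e. e \<notin> F' \<Longrightarrow> c' e = 0" "y = (\<Sum>e\<in>F'. c' e)"
    by (elim graded_sumE) metis
  have "x = (\<Sum>e\<in>F \<union> F'. c e)" "y = (\<Sum>e\<in>F \<union> F'. c' e)"
    unfolding x(4) y(4) using x(2,3) y(2,3) by (auto intro!: sum.mono_neutral_left)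
  then have "x + y = (\<Sum>e\<in>F \<union> F'. c e + c' e)"
    by (simp add: sum.distrib)
  then show "x + y \<in> graded_sum G"
    using sum_in_graded_sum[of G "F \<union> F'" "\<lambda>e. c e + c' e"] G x(1,2) y(1,2) subspace_add by auto
next
  fix a x assume "x \<in> graded_sum G"
  then obtain c F where x: "\<And>e. c e \<in> G e" "finite F" "x = (\<Sum>e\<in>F. c e)"
    by (elim graded_sumE) metis
  then show "a *s x \<in> graded_sum G"
    using sum_in_graded_sum[of G F "\<lambda>e. a *s c e"] G subspace_scale by (simp add: scale_sum_right)
qed

text \<open>
  Homogeneous components can be recovered from a sum: the coefficient at \<open>\<alpha>\<close> comes from the
  component of degree \<open>total_deg \<alpha>\<close> only.
\<close>

lemma Mat_homog_sum_unique:
  fixes c c' :: "nat \<Rightarrow> ('n::finite, 'k::field) diff_poly ^ 'n ^ 'n"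
  assumes "\<And>e. c e \<in> Mat_homog e" "finite {e. c e \<noteq> 0}"
    and "\<And>e. c' e \<in> Mat_homog e" "finite {e. c' e \<noteq> 0}"
    and eq: "(\<Sum>e | c e \<noteq> 0. c e) = (\<Sum>e | c' e \<noteq> 0. c' e)"
  shows "c = c'"
proof -
  have component: "Poly_Mapping.lookup ((\<Sum>e | b e \<noteq> 0. b e) $ i $ j) \<alpha> =
      Poly_Mapping.lookup (b (total_deg \<alpha>) $ i $ j) \<alpha>"
    if b: "\<And>e. b e \<in> Mat_homog e" "finite {e. b e \<noteq> 0}"
    for b :: "nat \<Rightarrow> ('n, 'k) diff_poly ^ 'n ^ 'n" and i j \<alpha>
  proof -
    have "Poly_Mapping.lookup ((\<Sum>e | b e \<noteq> 0. b e) $ i $ j) \<alpha> =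
        (\<Sum>e | b e \<noteq> 0. Poly_Mapping.lookup (b e $ i $ j) \<alpha>)"
      by (simp add: lookup_sum)
    also have "\<dots> = (\<Sum>e | b e \<noteq> 0.
        if e = total_deg \<alpha> then Poly_Mapping.lookup (b e $ i $ j) \<alpha> else 0)"
      using b(1) by (intro sum.cong refl) (auto simp: Mat_homog_def homog_iff)
    also have "\<dots> = Poly_Mapping.lookup (b (total_deg \<alpha>) $ i $ j) \<alpha>"
      using b(2) by (simp add: sum.delta')
    finally show ?thesis .
  qed
  have "Poly_Mapping.lookup (c e $ i $ j) \<alpha> = Poly_Mapping.lookup (c' e $ i $ j) \<alpha>" for e i j \<alpha>
  proof (cases "total_deg \<alpha> = e")
    case True
    then show ?thesis using component[of c i j \<alpha>] component[of c' i j \<alpha>] assms by simp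
  next
    case False
    then show ?thesis using assms(1,3) by (simp add: Mat_homog_def homog_iff)
  qed
  then show ?thesis
    by (simp add: fun_eq_iff vec_eq_iff poly_mapping_eq_iff)
qed

lemma M_hat_subspace: "mat.subspace (M_hat d f)"
  unfolding M_hat_def by (rule mat.graded_sum_subspace[OF M_hat_part_subspace])

lemma M_hat_part_subset: "M_hat_part d f e \<subseteq> M_hat d f"
proof
  fix A assume "A \<in> M_hat_part d f e"
  then show "A \<in> M_hat d f"
    using mat.sum_in_graded_sum[OF M_hat_part_subspace, of "{e}" "\<lambda>_. A"] by (simp add: M_hat_def)
qed

lemma matrix_add_rdistrib:
  fixes A B :: "'a::semiring_1 ^ 'n ^ 'm"
  shows "(A + B) ** C = A ** C + B ** C"
  by (simp add: matrix_matrix_mult_def vec_eq_iff distrib_right sum.distrib)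

lemma matrix_mult_sum_sum:
  fixes A :: "'i \<Rightarrow> 'a::semiring_1 ^ 'n ^ 'm" and B :: "'j \<Rightarrow> 'a ^ 'p ^ 'n"
  shows "(\<Sum>i\<in>I. A i) ** (\<Sum>j\<in>J. B j) = (\<Sum>i\<in>I. \<Sum>j\<in>J. A i ** B j)"
proof -
  have left: "(\<Sum>i\<in>I. A i) ** C = (\<Sum>i\<in>I. A i ** C)" for C :: "'a ^ 'p ^ 'n"
    by (induction I rule: infinite_finite_induct) (simp_all add: matrix_add_rdistrib)
  have right: "C ** (\<Sum>j\<in>J. B j) = (\<Sum>j\<in>J. C ** B j)" for C :: "'a ^ 'n ^ 'm"
    by (induction J rule: infinite_finite_induct) (simp_all add: matrix_add_ldistrib)
  show ?thesis by (simp only: left right) (rule sum.swap)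
qed

lemma M_hat_mult:
  assumes f: "f \<in> homog d" and "A \<in> M_hat d f" "B \<in> M_hat d f"
  shows "A ** B \<in> M_hat d f"
proof -
  obtain c F where A: "\<And>e. c e \<in> M_hat_part d f e" "A = (\<Sum>e\<in>F. c e)"
    using assms(2) unfolding M_hat_def by (elim graded_sumE) metis
  obtain c' F' where B: "\<And>e. c' e \<in> M_hat_part d f e" "B = (\<Sum>e\<in>F'. c' e)"
    using assms(3) unfolding M_hat_def by (elim graded_sumE) metis
  have "c i ** c' j \<in> M_hat d f" for i j
    using M_hat_part_mult[OF f A(1) B(1)] M_hat_part_subset by blast
  then show ?thesis
    unfolding A(2) B(2) matrix_mult_sum_sum by (intro mat.subspace_sum[OF M_hat_subspace])
qed

lemma M_hat_graded_algebra:
  fixes f :: "('n::finite, 'k::field) div_pow"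
  assumes f: "f \<in> homog d"
  shows "graded_algebra mat_scale (**) (mat 1) (M_hat d f) (M_hat_part d f)"
proof (rule graded_algebra.intro[OF mat_scale_vector_space], unfold_locales)
  show "mat.subspace (M_hat d f)" by (rule M_hat_subspace)
  show "mat.subspace (M_hat_part d f e)" for e by (rule M_hat_part_subspace)
  show "M_hat_part d f e \<subseteq> M_hat d f" for e by (rule M_hat_part_subset)
  show one: "mat 1 \<in> M_hat_part d f 0" by (rule one_in_M_hat_part)
  then show "mat 1 \<in> M_hat d f" using M_hat_part_subset by blast
  show "A ** B \<in> M_hat d f" if "A \<in> M_hat d f" "B \<in> M_hat d f" for A B
    using M_hat_mult[OF f that] .
  show "A ** B \<in> M_hat_part d f (i + j)" if "A \<in> M_hat_part d f i" "B \<in> M_hat_part d f j" for A B i j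
    using M_hat_part_mult[OF f that] .
  show "\<exists>!c. (\<forall>e. c e \<in> M_hat_part d f e) \<and> finite {e. c e \<noteq> 0} \<and> A = (\<Sum>e | c e \<noteq> 0. c e)"
    if "A \<in> M_hat d f" for A
  proof (rule ex_ex1I)
    show "\<exists>c. (\<forall>e. c e \<in> M_hat_part d f e) \<and> finite {e. c e \<noteq> 0} \<and> A = (\<Sum>e | c e \<noteq> 0. c e)"
      using that by (simp add: M_hat_def graded_sum_def)
  next
    fix c c'
    assume "(\<forall>e. c e \<in> M_hat_part d f e) \<and> finite {e. c e \<noteq> 0} \<and> A = (\<Sum>e | c e \<noteq> 0. c e)"
      and "(\<forall>e. c' e \<in> M_hat_part d f e) \<and> finite {e. c' e \<noteq> 0} \<and> A = (\<Sum>e | c' e \<noteq> 0. c' e)"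
    then show "c = c'"
      using M_hat_part_subset_Mat_homog by (intro Mat_homog_sum_unique) blast+
  qed
qed (simp_all add: matrix_mul_assoc matrix_add_ldistrib matrix_add_rdistrib
      mat_scale_mult_left mat_scale_mult_right)

theorem proposition5p5:
  fixes f :: "('n::finite, 'k::field) div_pow" and d :: nat
  assumes "f \<in> homog d"
  shows "(\<forall>a b. a + b + 3 \<le> d \<longrightarrow>
            (\<forall>A \<in> M f a. \<forall>B \<in> M f b. A ** B \<in> M f (a + b)) \<and>
            (\<forall>A \<in> M f a. \<forall>B \<in> M f b. A ** B - B ** A \<in> ker_gamma d f (a + b))) \<and>
         graded_algebra mat_scale (**) (mat 1) (M_hat d f) (M_hat_part d f)"
  using M_mult_closed[OF assms] commutator_in_ker_gamma[OF assms] M_hat_graded_algebra[OF assms]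
  by blast

end
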